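(* Let $a,b,c$ be positive integers with $D:=b^2-ac>0$. For generic nonzero complex $x_1,x_2,y_1$, \[\begin{split} \sum_{r_1,s_1\in\mathbb{Z}} &\mathrm{sg}(r_1,s_1)\, q^{\frac12a r_1^2+br_1s_1+\frac12cs_1^2}\, x_1^{r_1}y_1^{s_1}\\ &=\sum_{t=0}^{c-1} \sum_{s_1\in\mathbb{Z}} q^{\frac12a t^2+bts_1+\frac12cs_1^2}x_1^t y_1^{s_1}\Bigl(\sum_{r_2\in\mathbb{Z}} q^{\frac12 cDr_2^2}\, x_2^{r_2}\Bigr)^{-1}\sum_{r_2\in\mathbb{Z}}\frac{q^{\frac12 cDr_2^2} x_2^{r_2}}{1-x_1^cy_1^{-b}x_2 q^{D(cr_2-t)}}\\ &\quad +\Bigl(\sum_{r_2\in\mathbb{Z}} q^{\frac12 cDr_2^2}\, x_2^{r_2}\Bigr)^{-1} \sum_{u\bmod b^2} \sum_{v=0}^{b-1} q^{\frac12 au^2+buv+\frac12 cv^2} x_1^uy_1^v\\ &\qquad \cdot \sum_{r_2\in\mathbb{Z}} q^{\frac12 b^2cr_2^2+c(au+bv)r_2}(x_1^cx_2)^{r_2} \sum_{k\in\mathbb{Z}} \frac{q^{\frac12 ab^2Dk^2+(au+bv)Dk}(x_1^Dx_2^{-a})^k}{1- x_1^{-c}y_1^b x_2^{-1} q^{D(b^2k+u)}}, \end{split}\] where $u$ runs over a complete residue system modulo $b^2$.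
   Context: Let $q$ be a complex number with $0<|q|<1$ (fractional powers via $q=e^{2\pi i\tau}$). Let $\mathrm{sg}(r)=1$ if $r\ge0$ and $-1$ if $r<0$, and $\mathrm{sg}(r,s):=(\mathrm{sg}(r)+\mathrm{sg}(s))/2$. *)

theory Defs
  imports "HOL-Analysis.Analysis"
begin

(* Fractional powers of q = exp (2 * pi * i * tau): the branch is fixed by the choice of tau,
   so this is in general not "q powr e", which uses the principal logarithm. *)
definition qpow :: "complex \<Rightarrow> real \<Rightarrow> complex" where
  "qpow \<tau> e = exp (2 * of_real pi * \<i> * \<tau> * of_real e)"

(* Unlike the library's sgn, sg 0 = 1. *)
definition sg :: "int \<Rightarrow> complex" where
  "sg r = (if r \<ge> 0 then 1 else - 1)"

definition sg2 :: "int \<Rightarrow> int \<Rightarrow> complex" where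
  "sg2 r s = (sg r + sg s) / 2"

definition complete_residue_system :: "int \<Rightarrow> int set \<Rightarrow> bool" where
  "complete_residue_system m U \<longleftrightarrow> (\<forall>n. \<exists>!u. u \<in> U \<and> u mod m = n mod m)"

end

theory Submission
  imports Defs
begin

text \<open>
  Multiply the left-hand side by the theta function in \<open>x\<^sub>2\<close> and sum over triples
  \<open>(r, s, t)\<close> with \<open>t\<close> the theta index. The shift \<open>(r, s, t) \<mapsto> (r + c, s - b, t + 1)\<close> multiplies the
  monomial by \<open>w = x\<^sub>1\<^sup>c y\<^sub>1\<^bsup>-b\<^esup> x\<^sub>2 q\<^bsup>D(ct - r)\<^esup>\<close>, which is constant along the orbits. Along an orbit \<open>r\<close>
  increases and \<open>s\<close> decreases, so only finitely many signs are nonzero and the orbit contributes a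
  finite geometric sum. Its two end terms are \<open>1 / (1 - w)\<close> at the orbit point with \<open>0 \<le> r < c\<close> and
  \<open>1 / (1 - w\<^bsup>-1\<^esup>)\<close> at the one with \<open>0 \<le> s < b\<close>; on both of these slices the quadratic form is
  positive definite, and summing over them gives the two terms on the right-hand side. As the
  geometric sums are finite, no restriction on the size of \<open>w\<close> and no analytic continuation is needed.
\<close>

section \<open>Summation\<close>

lemma summable_on_intI:
  fixes f :: "int \<Rightarrow> 'a::banach"
  assumes "(\<lambda>n::nat. f (int n)) summable_on UNIV"
    and "(\<lambda>n::nat. f (- int (Suc n))) summable_on UNIV"
  shows "f summable_on UNIV"
proof -
  have "f summable_on range int"
    using assms(1) by (subst summable_on_reindex) (auto simp: o_def)
  moreover have "f summable_on range (\<lambda>n. - int (Suc n))"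
    using assms(2) by (subst summable_on_reindex) (auto simp: o_def inj_def)
  moreover have "range int \<inter> range (\<lambda>n. - int (Suc n)) = {}"
    by auto
  ultimately have "f summable_on (range int \<union> range (\<lambda>n. - int (Suc n)))"
    by (rule summable_on_Un_disjoint)
  also have "range int \<union> range (\<lambda>n. - int (Suc n)) = UNIV"
  proof (rule UNIV_eq_I[symmetric])
    show "n \<in> range int \<union> range (\<lambda>n. - int (Suc n))" for n
      by (cases n) blast+
  qed
  finally show ?thesis .
qed

lemma summable_on_power_nat_abs:
  fixes x :: real
  assumes "0 \<le> x" "x < 1"
  shows "(\<lambda>n::int. x ^ nat \<bar>n\<bar>) summable_on UNIV"
proof (rule summable_on_intI)
  show "(\<lambda>n::nat. x ^ nat \<bar>int n\<bar>) summable_on UNIV"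
    by (rule norm_summable_imp_summable_on) (use assms in \<open>simp add: power_abs summable_geometric\<close>)
  have "nat \<bar>- int (Suc n)\<bar> = Suc n" for n by simp
  moreover have "(\<lambda>n::nat. x ^ Suc n) summable_on UNIV"
    by (rule norm_summable_imp_summable_on)
      (use assms in \<open>simp add: power_abs summable_geometric summable_mult abs_mult\<close>)
  ultimately show "(\<lambda>n::nat. x ^ nat \<bar>- int (Suc n)\<bar>) summable_on UNIV"
    by presburger
qed

lemma summable_on_exp_quadratic:
  fixes \<alpha> \<beta> \<gamma> :: complex
  assumes "Re \<alpha> < 0"
  shows "(\<lambda>n::int. exp (\<alpha> * of_int n ^ 2 + \<beta> * of_int n + \<gamma>)) summable_on UNIV"
proof -
  \<comment> \<open>The extra 1 in \<open>B\<close> buys the decay: completing the square bounds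
    \<open>B * m - A * m^2\<close> by a constant, and the surplus \<open>- m\<close> makes the
    comparison series geometric in \<open>\<bar>n\<bar>\<close> with ratio
    \<open>exp (-1)\<close>.\<close>
  define A B where "A = - Re \<alpha>" and "B = \<bar>Re \<beta>\<bar> + 1"
  define K where "K = B^2 / (4 * A) + Re \<gamma>"
  have A: "A > 0" using assms by (simp add: A_def)
  have le: "norm (exp (\<alpha> * of_int n ^ 2 + \<beta> * of_int n + \<gamma>)) \<le> exp K * exp (-1) ^ nat \<bar>n\<bar>" for n :: int
  proof -
    define m where "m = \<bar>real_of_int n\<bar>"
    have m: "real (nat \<bar>n\<bar>) = m" "m^2 = of_int n ^ 2" by (auto simp: m_def)
    have "0 \<le> A * (m - B / (2 * A))^2" using A by simp
    also have "\<dots> = A * m^2 - B * m + B^2 / (4 * A)"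
      using A by (simp add: field_simps power2_eq_square)
    finally have 1: "B * m - A * m^2 \<le> B^2 / (4 * A)" by simp
    have "Re \<beta> * of_int n \<le> \<bar>Re \<beta>\<bar> * m"
      unfolding m_def by (metis abs_ge_self abs_mult)
    also have "\<dots> = B * m - m" by (simp add: B_def algebra_simps)
    finally have 2: "Re \<beta> * of_int n \<le> B * m - m" .
    have "Re (\<alpha> * of_int n ^ 2 + \<beta> * of_int n + \<gamma>) = - A * m^2 + Re \<beta> * of_int n + Re \<gamma>"
      unfolding m A_def by (simp flip: of_int_power)
    also have "\<dots> \<le> K - m" using 1 2 unfolding K_def by linarith
    finally have "norm (exp (\<alpha> * of_int n ^ 2 + \<beta> * of_int n + \<gamma>)) \<le> exp (K - m)"
      by simp
    also have "exp (K - m) = exp K * exp (-1) ^ nat \<bar>n\<bar>"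
      by (simp add: m flip: exp_of_nat_mult exp_add)
    finally show ?thesis .
  qed
  have "(\<lambda>n::int. exp K * exp (-1) ^ nat \<bar>n\<bar>) summable_on UNIV"
    by (intro summable_on_cmult_right summable_on_power_nat_abs) auto
  then have "(\<lambda>n::int. norm (exp (\<alpha> * of_int n ^ 2 + \<beta> * of_int n + \<gamma>))) summable_on UNIV"
    by (rule Infinite_Sum.abs_summable_on_comparison_test') (use le in auto)
  then show ?thesis by (rule abs_summable_summable)
qed

text \<open>Summable complex families are absolutely summable, so the product family is absolutely
  summable too, and its sum may be computed as an iterated sum.\<close>

lemma has_sum_product_complex:
  fixes f :: "'a \<Rightarrow> complex" and g :: "'b \<Rightarrow> complex"
  assumes f: "(f has_sum S) A" and g: "(g has_sum T) B"
  shows "((\<lambda>(x,y). f x * g y) has_sum (S * T)) (A \<times> B)"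
proof (rule has_sum_SigmaI)
  show "((\<lambda>y. case (x, y) of (x, y) \<Rightarrow> f x * g y) has_sum (f x * T)) B" for x
    using has_sum_cmult_right[OF g, of "f x"] by simp
  show "((\<lambda>x. f x * T) has_sum (S * T)) A"
    using has_sum_cmult_left[OF f, of T] by simp
  have "(\<lambda>x. norm (f x)) summable_on A" "(\<lambda>y. norm (g y)) summable_on B"
    using f g has_sum_imp_summable summable_on_iff_abs_summable_on_complex by blast+
  then obtain T' where T': "((\<lambda>y. norm (g y)) has_sum T') B"
      and f': "(\<lambda>x. norm (f x)) summable_on A"
    by (auto simp: summable_on_def)
  have "(\<lambda>(x,y). norm (f x) * norm (g y)) summable_on (A \<times> B)"
  proof (rule summable_on_SigmaI)
    show "((\<lambda>y. case (x, y) of (x, y) \<Rightarrow> norm (f x) * norm (g y)) has_sum (norm (f x) * T')) B" for x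
      using has_sum_cmult_right[OF T', of "norm (f x)"] by simp
    show "(\<lambda>x. norm (f x) * T') summable_on A"
      using f' by (rule summable_on_cmult_left)
  qed auto
  then have "(\<lambda>p. norm (case p of (x,y) \<Rightarrow> f x * g y)) summable_on (A \<times> B)"
    by (simp add: case_prod_unfold norm_mult)
  then show "(\<lambda>(x,y). f x * g y) summable_on (A \<times> B)"
    by (rule abs_summable_summable)
qed

lemma has_sum_finite_Times:
  fixes f :: "'a \<Rightarrow> 'b \<Rightarrow> 'c::topological_comm_monoid_add"
  assumes "finite A" and "\<And>x. x \<in> A \<Longrightarrow> (f x has_sum S x) B"
  shows "((\<lambda>(x,y). f x y) has_sum (\<Sum>x\<in>A. S x)) (A \<times> B)"
  using assms
proof (induction A rule: finite_induct)
  case (insert x A)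
  have "((\<lambda>(x,y). f x y) has_sum S x) ({x} \<times> B)"
    using insert.prems[of x]
    by (subst has_sum_reindex_bij_witness[where T = B and j = snd and i = "Pair x" and h = "f x"]) auto
  moreover have "((\<lambda>(x,y). f x y) has_sum (\<Sum>x\<in>A. S x)) (A \<times> B)"
    using insert by auto
  moreover have "({x} \<times> B) \<inter> (A \<times> B) = {}" using insert.hyps by auto
  ultimately have "((\<lambda>(x,y). f x y) has_sum (S x + (\<Sum>x\<in>A. S x))) ({x} \<times> B \<union> A \<times> B)"
    by (rule has_sum_Un_disjoint)
  moreover have "{x} \<times> B \<union> A \<times> B = insert x A \<times> B" by auto
  ultimately show ?case using insert.hyps by simp
qed auto

section \<open>Signed geometric sums and bounds for geometric denominators\<close>

lemma sum_powi_atLeastLessThan: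
  fixes w :: "'a::field"
  assumes "w \<noteq> 0" "w \<noteq> 1" "i \<le> (j::int)"
  shows "(\<Sum>n\<in>{i..<j}. w powi n) = (w powi i - w powi j) / (1 - w)"
  using assms(3)
proof (induction j rule: int_ge_induct)
  case (step j)
  have "{i..<j+1} = insert j {i..<j}" using step.hyps by auto
  then have "(\<Sum>n\<in>{i..<j+1}. w powi n) = w powi j + (w powi i - w powi j) / (1 - w)"
    using step by simp
  also have "\<dots> = (w powi i - w powi (j + 1)) / (1 - w)"
    using assms by (simp add: field_simps power_int_add)
  finally show ?case .
qed auto

lemma sg2_eq:
  "sg2 r s = (if 0 \<le> r \<and> 0 \<le> s then 1 else if r < 0 \<and> s < 0 then -1 else 0)"
  by (simp add: sg2_def sg_def)

text \<open>The model of the sum along one orbit. For N >= 0 the sign is 1 exactly on 0..N, for N <=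
  -2 it is -1 exactly on N+1..-1, and for N = -1 it vanishes everywhere; these finite geometric sums
  share one closed form.\<close>

lemma has_sum_sg2_powi:
  fixes w :: complex
  assumes "w \<noteq> 0" "w \<noteq> 1"
  shows "((\<lambda>n. sg2 n (N - n) * w powi n) has_sum ((1 - w powi (N + 1)) / (1 - w))) UNIV"
proof (cases "N + 1 \<ge> 0")
  case True
  show ?thesis
    by (rule has_sum_finite_neutralI[where B = "{0..<N+1}"])
      (use True sum_powi_atLeastLessThan[OF assms True] in \<open>auto simp: sg2_eq\<close>)
next
  case False
  then have "(\<Sum>n\<in>{N+1..<0}. - (w powi n)) = (1 - w powi (N + 1)) / (1 - w)"
    using sum_powi_atLeastLessThan[OF assms, of "N+1" 0] 
    by (simp add: sum_negf minus_divide_left)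
  then show ?thesis
    by (intro has_sum_finite_neutralI[where B = "{N+1..<0}"])
      (use False in \<open>auto simp: sg2_eq intro!: sum.cong\<close>)
qed

text \<open>Keeps theta series summable after division by the factors \<open>1 - w m\<close> and
  \<open>1 - w' m\<close> below. The exponential decays in one direction of \<open>m\<close> and
  grows in the other, so the quotients tend to 1 and to 0 and are bounded on each half.\<close>

lemma bounded_inverse_one_minus_geometric:
  fixes v \<delta> :: complex
  assumes "Re \<delta> < 0" and "\<And>m::int. exp (v + of_int m * \<delta>) \<noteq> 1"
  obtains B where "\<And>m::int. norm (1 / (1 - exp (v + of_int m * \<delta>))) \<le> B"
proof -
  have lim: "(\<lambda>n. exp (u + of_nat n * \<delta>)) \<longlonglongrightarrow> 0" for u
  proof -
    have "norm (exp \<delta>) < 1" using assms(1) by simp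
    then have "(\<lambda>n. exp u * exp \<delta> ^ n) \<longlonglongrightarrow> exp u * 0"
      by (intro tendsto_intros LIMSEQ_power_zero)
    then show ?thesis by (simp add: exp_add exp_of_nat_mult)
  qed
  have "(\<lambda>n. 1 / (1 - exp (v + of_nat n * \<delta>))) \<longlonglongrightarrow> 1 / (1 - 0)"
    by (intro tendsto_intros lim) auto
  then have "Bseq (\<lambda>n. 1 / (1 - exp (v + of_nat n * \<delta>)))"
    by (rule convergent_imp_Bseq[OF convergentI])
  then obtain B1 where B1: "\<And>n. norm (1 / (1 - exp (v + of_nat n * \<delta>))) \<le> B1"
    unfolding Bseq_def by blast
  \<comment> \<open>Multiplying through by \<open>exp (- v + of_nat n * \<delta>)\<close> replaces
    the growing exponential by a decaying one, so \<open>lim\<close> also settles the negative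
    indices.\<close>
  have eq: "1 / (1 - exp (v - of_nat n * \<delta>))
      = exp (- v + of_nat n * \<delta>) / (exp (- v + of_nat n * \<delta>) - 1)" for n
  proof -
    have "exp (- v + of_nat n * \<delta>) * exp (v - of_nat n * \<delta>) = 1"
      by (simp flip: exp_add)
    then have "exp (- v + of_nat n * \<delta>) - 1 = exp (- v + of_nat n * \<delta>) * (1 - exp (v - of_nat n * \<delta>))"
      by (simp add: algebra_simps)
    then show ?thesis by simp
  qed
  have "(\<lambda>n. exp (- v + of_nat n * \<delta>) / (exp (- v + of_nat n * \<delta>) - 1)) \<longlonglongrightarrow> 0 / (0 - 1)"
    by (intro tendsto_intros lim) auto
  then have "Bseq (\<lambda>n. 1 / (1 - exp (v - of_nat n * \<delta>)))"
    unfolding eq by (rule convergent_imp_Bseq[OF convergentI])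
  then obtain B2 where B2: "\<And>n. norm (1 / (1 - exp (v - of_nat n * \<delta>))) \<le> B2"
    unfolding Bseq_def by blast
  have "norm (1 / (1 - exp (v + of_int m * \<delta>))) \<le> max B1 B2" for m
  proof (cases m rule: int_cases2)
    case (nonneg n)
    then show ?thesis using B1[of n] by simp
  next
    case (nonpos n)
    then show ?thesis using B2[of n] by simp
  qed
  then show ?thesis by (rule that)
qed

lemma summable_on_mult_bounded:
  fixes f g :: "'a \<Rightarrow> complex"
  assumes f: "f summable_on A" and g: "\<And>x. x \<in> A \<Longrightarrow> norm (g x) \<le> B"
  shows "(\<lambda>x. f x * g x) summable_on A"
proof -
  have "(\<lambda>x. norm (f x)) summable_on A"
    using f summable_on_iff_abs_summable_on_complex by blast
  then have "(\<lambda>x. norm (f x) * B) summable_on A"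
    by (rule summable_on_cmult_left)
  then have "(\<lambda>x. norm (f x * g x)) summable_on A"
    by (rule Infinite_Sum.abs_summable_on_comparison_test')
      (simp add: norm_mult g mult_left_mono)
  then show ?thesis by (rule abs_summable_summable)
qed

section \<open>Integer division and residue systems\<close>

lemma diff_mult_nonneg_iff_le_div:
  fixes m n s :: int
  assumes "0 < m"
  shows "0 \<le> s - m * n \<longleftrightarrow> n \<le> s div m"
proof -
  have "(s - m * n) div m = s div m - n"
    using assms div_mult_self2[of m s "- n"] by simp
  then show ?thesis using assms pos_imp_zdiv_nonneg_iff[of m "s - m * n"] by auto
qed

lemma complete_residue_system_finite:
  assumes "complete_residue_system m U" "m > 0"
  shows "finite U"
proof (rule inj_on_finite)
  show "inj_on (\<lambda>u. u mod m) U"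
    using assms(1) unfolding complete_residue_system_def inj_on_def by blast
  show "(\<lambda>u. u mod m) ` U \<subseteq> {0..<m}" using assms(2) by auto
qed auto

section \<open>The orbit decomposition\<close>

text \<open>Here \<open>\<kappa>\<close>, \<open>X1\<close>, \<open>Y1\<close>, \<open>X2\<close>
  are logarithms of q, x1, y1, x2. Every product of powers becomes a single exponential, so
  identities between terms reduce to polynomial identities between exponents.\<close>

locale indefinite_theta =
  fixes a b c D :: int and \<kappa> X1 Y1 X2 :: complex
  assumes a_pos: "a > 0" and b_pos: "b > 0" and c_pos: "c > 0"
    and D_eq: "D = b^2 - a * c" and D_pos: "D > 0"
    and Re_\<kappa>: "Re \<kappa> < 0"
    and no_pole: "\<And>m::int. exp (of_int c * X1 - of_int b * Y1 + X2 + of_int m * (\<kappa> * of_int D)) \<noteq> 1"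
begin

text \<open>The ratio of consecutive terms on an orbit; \<open>m\<close> stands for
  \<open>c * t - r\<close>, which the shift leaves unchanged. In \<open>w'\<close> the ratio is
  inverted and the invariant negated, to match the denominators of the second term on the right-hand
  side.\<close>

definition w :: "int \<Rightarrow> complex" where
  "w m = exp (of_int c * X1 - of_int b * Y1 + X2 + of_int m * (\<kappa> * of_int D))"

definition w' :: "int \<Rightarrow> complex" where
  "w' m = exp (- of_int c * X1 + of_int b * Y1 - X2 + of_int m * (\<kappa> * of_int D))"

definition G :: "int \<Rightarrow> int \<Rightarrow> complex" where
  "G r s = exp (\<kappa> * (of_int a * of_int r^2 / 2 + of_int b * of_int r * of_int s + of_int c * of_int s^2 / 2)
     + of_int r * X1 + of_int s * Y1)"

definition \<Theta> :: "int \<Rightarrow> complex" where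
  "\<Theta> t = exp (\<kappa> * (of_int c * of_int D * of_int t^2 / 2) + of_int t * X2)"

text \<open>\<open>R\<close> is the term of the series in \<open>r2\<close> (index \<open>t\<close>
  here) and \<open>K\<close> the numerator in the series in \<open>k\<close>; with
  \<open>G u v\<close> they are the factors of \<open>F\<close> on a slice of fixed
  \<open>s\<close>.\<close>

definition R :: "int \<Rightarrow> int \<Rightarrow> int \<Rightarrow> complex" where
  "R u v t = exp (\<kappa> * (of_int b^2 * of_int c * of_int t^2 / 2
      + of_int c * (of_int a * of_int u + of_int b * of_int v) * of_int t)
     + of_int t * (of_int c * X1 + X2))"

definition K :: "int \<Rightarrow> int \<Rightarrow> int \<Rightarrow> complex" where
  "K u v k = exp (\<kappa> * (of_int a * of_int b^2 * of_int D * of_int k^2 / 2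
      + (of_int a * of_int u + of_int b * of_int v) * of_int D * of_int k)
     + of_int k * (of_int D * X1 - of_int a * X2))"

abbreviation F :: "int \<Rightarrow> int \<Rightarrow> int \<Rightarrow> complex" where
  "F r s t \<equiv> G r s * \<Theta> t"

lemma of_int_D: "of_int D = (of_int b^2 - of_int a * of_int c :: complex)"
  by (simp add: D_eq)

lemma w_nonzero: "w m \<noteq> 0" and w_neq_1: "w m \<noteq> 1"
  using no_pole by (simp_all add: w_def)

lemma w'_eq: "w' m = inverse (w (- m))"
  unfolding w_def w'_def exp_minus[symmetric] by (simp add: algebra_simps)

lemma w'_neq_1: "w' m \<noteq> 1"
  using w_neq_1 by (simp add: w'_eq)

text \<open>The vector (c, -b, 1) is isotropic for the ternary form in the exponent, because
  \<open>a * c - b^2 + D = 0\<close>. Hence the exponent is affine in \<open>n\<close>, and the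
  \<open>\<kappa>\<close> part of its slope is \<open>D * (c * t - r)\<close>, free of
  \<open>s\<close>.\<close>

lemma F_shift: "F (r + c * n) (s - b * n) (t + n) = w (c * t - r) powi n * F r s t"
  unfolding G_def \<Theta>_def w_def exp_power_int exp_add[symmetric]
  by (rule arg_cong[where f = exp]) (simp add: of_int_D field_simps power2_eq_square)

text \<open>On the hyperplane \<open>s = v\<close> this substitution diagonalises the quadratic form and turns
  \<^term>\<open>r - c * t\<close> into \<^term>\<open>b^2 * k + u\<close>.\<close>

lemma F_split: "F (u + c * t + D * k) v (t - a * k) = G u v * (R u v t * K u v k)"
  unfolding G_def \<Theta>_def R_def K_def exp_add[symmetric]
  by (rule arg_cong[where f = exp]) (simp add: of_int_D field_simps power2_eq_square)

section \<open>Summability of the theta series, of their quotients and of the indefinite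
  series\<close>

lemma Re_mult_pos: "k > 0 \<Longrightarrow> Re (\<kappa> * of_int k / 2) < 0"
  using Re_\<kappa> by (simp add: mult_neg_pos)

lemma summable_\<Theta>: "\<Theta> summable_on UNIV"
proof -
  have "Re (\<kappa> * of_int (c * D) / 2) < 0"
    by (rule Re_mult_pos) (use c_pos D_pos in simp)
  then have "(\<lambda>t::int. exp (\<kappa> * of_int (c * D) / 2 * of_int t^2 + X2 * of_int t + 0)) summable_on UNIV"
    by (rule summable_on_exp_quadratic)
  then show ?thesis unfolding \<Theta>_def by (simp add: algebra_simps)
qed

lemma summable_G: "G r summable_on UNIV"
proof -
  have "Re (\<kappa> * of_int c / 2) < 0" by (rule Re_mult_pos) (rule c_pos)
  then have "(\<lambda>s::int. exp (\<kappa> * of_int c / 2 * of_int s^2 + (\<kappa> * of_int b * of_int r + Y1) * of_int s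
      + (\<kappa> * of_int a * of_int r^2 / 2 + of_int r * X1))) summable_on UNIV"
    by (rule summable_on_exp_quadratic)
  then show ?thesis unfolding G_def by (simp add: algebra_simps)
qed

lemma summable_R: "R u v summable_on UNIV"
proof -
  have "Re (\<kappa> * of_int (b^2 * c) / 2) < 0"
    by (rule Re_mult_pos) (use b_pos c_pos in simp)
  then have "(\<lambda>t::int. exp (\<kappa> * of_int (b^2 * c) / 2 * of_int t^2
      + (\<kappa> * of_int c * (of_int a * of_int u + of_int b * of_int v) + of_int c * X1 + X2) * of_int t + 0))
      summable_on UNIV"
    by (rule summable_on_exp_quadratic)
  then show ?thesis unfolding R_def by (simp add: algebra_simps)
qed

lemma summable_K: "K u v summable_on UNIV"
proof -
  have "Re (\<kappa> * of_int (a * b^2 * D) / 2) < 0"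
    by (rule Re_mult_pos) (use a_pos b_pos D_pos in simp)
  then have "(\<lambda>k::int. exp (\<kappa> * of_int (a * b^2 * D) / 2 * of_int k^2
      + (\<kappa> * (of_int a * of_int u + of_int b * of_int v) * of_int D + of_int D * X1 - of_int a * X2) * of_int k + 0))
      summable_on UNIV"
    by (rule summable_on_exp_quadratic)
  then show ?thesis unfolding K_def by (simp add: algebra_simps)
qed

lemma w_bounded:
  obtains B where "\<And>m. norm (1 / (1 - w m)) \<le> B"
proof (rule bounded_inverse_one_minus_geometric)
  show "Re (\<kappa> * of_int D) < 0" using Re_\<kappa> D_pos by (simp add: mult_neg_pos)
qed (use no_pole in \<open>auto simp: w_def intro: that\<close>)

lemma w'_bounded:
  obtains B where "\<And>m. norm (1 / (1 - w' m)) \<le> B"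
proof (rule bounded_inverse_one_minus_geometric)
  show "Re (\<kappa> * of_int D) < 0" using Re_\<kappa> D_pos by (simp add: mult_neg_pos)
qed (use w'_neq_1 in \<open>auto simp: w'_def intro: that\<close>)

lemma summable_\<Theta>_over_w: "(\<lambda>t. \<Theta> t / (1 - w (c * t - r))) summable_on UNIV"
proof -
  obtain B where "\<And>m. norm (1 / (1 - w m)) \<le> B" using w_bounded by blast
  then have "(\<lambda>t. \<Theta> t * (1 / (1 - w (c * t - r)))) summable_on UNIV"
    by (intro summable_on_mult_bounded[OF summable_\<Theta>, where B = B])
  then show ?thesis by simp
qed

lemma summable_K_over_w': "(\<lambda>k. K u v k / (1 - w' (b^2 * k + u))) summable_on UNIV"
proof -
  obtain B where "\<And>m. norm (1 / (1 - w' m)) \<le> B" using w'_bounded by blast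
  then have "(\<lambda>k. K u v k * (1 / (1 - w' (b^2 * k + u)))) summable_on UNIV"
    by (intro summable_on_mult_bounded[OF summable_K, where B = B])
  then show ?thesis by simp
qed

text \<open>A nonzero sign forces \<open>0 \<le> r * s\<close>, so the mixed factor with exponent
  \<open>b * r * s\<close> has modulus at most 1. The product of two one-dimensional theta series
  then dominates.\<close>

lemma summable_sg2_G: "(\<lambda>(r, s). sg2 r s * G r s) summable_on UNIV"
proof -
  define g where "g k X n = exp (\<kappa> * of_int k / 2 * of_int n^2 + X * of_int n + 0)" for k X and n :: int
  have "g a X1 summable_on UNIV" "g c Y1 summable_on UNIV"
    unfolding g_def by (intro summable_on_exp_quadratic Re_mult_pos a_pos c_pos)+
  from this[THEN has_sum_infsum]
  have "(\<lambda>(r, s). g a X1 r * g c Y1 s) summable_on UNIV \<times> UNIV"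
    by (rule has_sum_imp_summable[OF has_sum_product_complex])
  then have "(\<lambda>p. (case p of (r, s) \<Rightarrow> g a X1 r * g c Y1 s)
      * (case p of (r, s) \<Rightarrow> sg2 r s * exp (\<kappa> * of_int (b * r * s)))) summable_on UNIV \<times> UNIV"
  proof (rule summable_on_mult_bounded[where B = 1], clarify)
    fix r s :: int
    show "norm (sg2 r s * exp (\<kappa> * of_int (b * r * s))) \<le> 1"
    proof (cases "sg2 r s = 0")
      case False
      then have "0 \<le> r * s" by (auto simp: sg2_eq mult_nonpos_nonpos split: if_splits)
      then have "0 \<le> real_of_int (b * r * s)"
        using b_pos by (simp only: mult.assoc of_int_0_le_iff) simp
      then have "Re (\<kappa> * of_int (b * r * s)) \<le> 0"
        using Re_\<kappa> by (simp add: mult_nonpos_nonneg)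
      then show ?thesis by (simp add: norm_mult sg2_eq)
    qed simp
  qed
  moreover have "G r s = g a X1 r * g c Y1 s * exp (\<kappa> * of_int (b * r * s))" for r s
    unfolding g_def G_def exp_add[symmetric]
    by (rule arg_cong[where f = exp]) (simp add: field_simps)
  then have "(case p of (r, s) \<Rightarrow> g a X1 r * g c Y1 s)
      * (case p of (r, s) \<Rightarrow> sg2 r s * exp (\<kappa> * of_int (b * r * s)))
     = (case p of (r, s) \<Rightarrow> sg2 r s * G r s)" for p
    by (cases p) simp
  ultimately show ?thesis by simp
qed

section \<open>The sum along an orbit and the two sums of end terms\<close>

lemma orbit_has_sum:
  assumes r: "0 \<le> r" "r < c"
  shows "((\<lambda>n. sg2 (r + c * n) (s - b * n) * F (r + c * n) (s - b * n) (t + n)) has_sum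
     (F r s t / (1 - w (c * t - r))
      + F (r + c * (s div b)) (s mod b) (t + s div b) / (1 - w' (r - c * t)))) UNIV"
proof -
  define x N where "x = w (c * t - r)" and "N = s div b"
  have x: "x \<noteq> 0" "x \<noteq> 1" by (auto simp: x_def w_nonzero w_neq_1)
  have mod: "s mod b = s - b * N" by (simp add: N_def minus_mult_div_eq_mod)
  \<comment> \<open>As \<open>0 \<le> r < c\<close>, the first coordinate is nonnegative exactly
    when \<open>0 \<le> n\<close>, and the second exactly when \<open>n \<le> N\<close>.\<close>
  have "sg2 (r + c * n) (s - b * n) = sg2 n (N - n)" for n
    using diff_mult_nonneg_iff_le_div[OF c_pos, of r "- n"] diff_mult_nonneg_iff_le_div[OF b_pos, of s n] r
    by (auto simp: sg2_eq N_def not_le[symmetric])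
  then have eq: "sg2 (r + c * n) (s - b * n) * F (r + c * n) (s - b * n) (t + n)
      = sg2 n (N - n) * x powi n * F r s t" for n
    by (simp only: F_shift x_def mult.assoc)
  \<comment> \<open>Since x^N / (1 - x^(-1)) = - x^(N+1) / (1 - x), the two end terms add up to the
    closed form of the geometric sum.\<close>
  have "F r s t / (1 - x) + F (r + c * N) (s - b * N) (t + N) / (1 - inverse x)
      = (1 - x powi (N + 1)) / (1 - x) * F r s t"
    using x unfolding F_shift x_def[symmetric]
    by (simp add: power_int_add divide_simps) (simp add: algebra_simps)
  moreover have "w' (r - c * t) = inverse x" by (simp add: w'_eq x_def)
  ultimately show ?thesis
    using has_sum_cmult_left[OF has_sum_sg2_powi[OF x, of N], of "F r s t"]
    by (simp only: eq mod flip: N_def x_def)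
qed

text \<open>\<open>A_sum\<close> and \<open>B_sum\<close> are the two terms on the right-hand side
  of the theorem after multiplication by the theta function in x2.\<close>

definition A_sum :: complex where
  "A_sum = (\<Sum>r\<in>{0..<c}. (\<Sum>\<^sub>\<infinity>s. G r s) * (\<Sum>\<^sub>\<infinity>t. \<Theta> t / (1 - w (c * t - r))))"

definition B_sum :: "int set \<Rightarrow> complex" where
  "B_sum U = (\<Sum>u\<in>U. \<Sum>v\<in>{0..<b}. G u v * (\<Sum>\<^sub>\<infinity>t. R u v t)
      * (\<Sum>\<^sub>\<infinity>k. K u v k / (1 - w' (b^2 * k + u))))"

lemma A_has_sum:
  "((\<lambda>(r, s, t). F r s t / (1 - w (c * t - r))) has_sum A_sum) ({0..<c} \<times> UNIV)"
proof -
  have "((\<lambda>(s, t). G r s * (\<Theta> t / (1 - w (c * t - r)))) has_sum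
     ((\<Sum>\<^sub>\<infinity>s. G r s) * (\<Sum>\<^sub>\<infinity>t. \<Theta> t / (1 - w (c * t - r))))) (UNIV \<times> UNIV)" for r
    by (intro has_sum_product_complex has_sum_infsum summable_G summable_\<Theta>_over_w)
  then have "((\<lambda>(r, p). case p of (s, t) \<Rightarrow> G r s * (\<Theta> t / (1 - w (c * t - r)))) has_sum A_sum)
      ({0..<c} \<times> (UNIV \<times> UNIV))"
    unfolding A_sum_def by (intro has_sum_finite_Times) auto
  then show ?thesis by simp
qed

text \<open>Writing \<open>r - c * t\<close> as \<open>b^2 * k + u\<close> with \<open>u\<close> in
  \<open>U\<close> makes the denominator depend on \<open>u\<close> and \<open>k\<close> alone. By
  \<open>F_split\<close> the sum for fixed \<open>(u, v)\<close> is then a product of a series in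
  \<open>t\<close> and one in \<open>k\<close>.\<close>

lemma B_has_sum:
  assumes U: "complete_residue_system (b^2) U"
  shows "((\<lambda>(r, s, t). F r s t / (1 - w' (r - c * t))) has_sum B_sum U) (UNIV \<times> {0..<b} \<times> UNIV)"
proof -
  \<comment> \<open>\<open>U\<close> is an arbitrary residue system, so the representative of a
    class is picked by uniqueness rather than by \<open>mod\<close>.\<close>
  define rep where "rep n = (THE u. u \<in> U \<and> u mod b^2 = n mod b^2)" for n
  have rep: "rep n \<in> U \<and> rep n mod b^2 = n mod b^2" for n
    unfolding rep_def by (rule theI') (use U in \<open>simp add: complete_residue_system_def\<close>)
  have rep_add: "rep (b^2 * k + u) = u" if "u \<in> U" for k u
  proof -
    have "rep (b^2 * k + u) mod b^2 = u mod b^2" using rep by simp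
    with rep that U show ?thesis unfolding complete_residue_system_def by blast
  qed
  have b0: "b^2 \<noteq> 0" using b_pos by simp
  have b2: "c * a + D = b^2" by (simp add: D_eq)
  have finU: "finite U"
    using U complete_residue_system_finite b_pos by simp
  have "((\<lambda>(t, k). G u v * R u v t * (K u v k / (1 - w' (b^2 * k + u)))) has_sum
     (G u v * (\<Sum>\<^sub>\<infinity>t. R u v t) * (\<Sum>\<^sub>\<infinity>k. K u v k / (1 - w' (b^2 * k + u))))) (UNIV \<times> UNIV)" for u v
    by (intro has_sum_product_complex has_sum_cmult_right has_sum_infsum summable_R summable_K_over_w')
  then have "((\<lambda>(x, p). case p of (t, k) \<Rightarrow> G (fst x) (snd x) * R (fst x) (snd x) t
        * (K (fst x) (snd x) k / (1 - w' (b^2 * k + fst x)))) has_sum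
      (\<Sum>x\<in>U \<times> {0..<b}. G (fst x) (snd x) * (\<Sum>\<^sub>\<infinity>t. R (fst x) (snd x) t)
         * (\<Sum>\<^sub>\<infinity>k. K (fst x) (snd x) k / (1 - w' (b^2 * k + fst x)))))
      ((U \<times> {0..<b}) \<times> (UNIV \<times> UNIV))"
    by (intro has_sum_finite_Times) (use finU in auto)
  also have "(\<Sum>x\<in>U \<times> {0..<b}. G (fst x) (snd x) * (\<Sum>\<^sub>\<infinity>t. R (fst x) (snd x) t)
         * (\<Sum>\<^sub>\<infinity>k. K (fst x) (snd x) k / (1 - w' (b^2 * k + fst x)))) = B_sum U"
    unfolding B_sum_def sum.cartesian_product by (simp add: case_prod_unfold)
  finally have *: "((\<lambda>(x, p). case p of (t, k) \<Rightarrow> G (fst x) (snd x) * R (fst x) (snd x) t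
        * (K (fst x) (snd x) k / (1 - w' (b^2 * k + fst x)))) has_sum B_sum U)
      ((U \<times> {0..<b}) \<times> (UNIV \<times> UNIV))" .
  \<comment> \<open>\<open>j\<close> is the substitution of \<open>F_split\<close>. Its inverse
    \<open>i\<close> recovers \<open>u\<close> and \<open>k\<close> from the invariant
    \<open>m\<close> and undoes the displacement of \<open>t\<close> by
    \<open>- a * k\<close>.\<close>
  define i where "i = (\<lambda>(r, s::int, t). let m = r - c * t; u = rep m; k = (m - u) div b^2 in ((u, s), (t + a * k, k)))"
  define j where "j = (\<lambda>((u, s), (t, k)). (u + c * t + D * k, s, t - a * k) :: int \<times> int \<times> int)"
  \<comment> \<open>The displaced \<open>t\<close> contributes \<open>c * a * k\<close>, and
    \<open>c * a + D = b^2\<close> turns the coefficient of \<open>k\<close> into the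
    modulus.\<close>
  have m: "u + c * t + D * k - c * (t - a * k) = b^2 * k + u" for u t k :: int
    by (simp add: b2[symmetric] algebra_simps)
  have k: "b^2 * ((m - rep m) div b^2) = m - rep m" for m
    using rep[of m] by (metis dvd_mult_div_cancel mod_eq_dvd_iff)
  from * show ?thesis
  proof (rule iffD1[OF has_sum_reindex_bij_witness[where i = i and j = j], rotated -1])
    fix x assume "x \<in> (U \<times> {0..<b}) \<times> (UNIV \<times> UNIV :: (int \<times> int) set)"
    then show "i (j x) = x" using b0
      by (auto simp: i_def j_def m rep_add Let_def)
  next
    fix x :: "int \<times> int \<times> int" assume x: "x \<in> UNIV \<times> {0..<b} \<times> UNIV"
    obtain r s t where [simp]: "x = (r, s, t)" by (cases x)
    define m where "m = r - c * t"
    have "rep m + c * (t + a * ((m - rep m) div b^2)) + D * ((m - rep m) div b^2)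
        = rep m + c * t + b^2 * ((m - rep m) div b^2)"
      by (simp add: b2[symmetric] algebra_simps)
    also have "\<dots> = r" by (simp add: k m_def)
    finally show "j (i x) = x"
      by (simp add: i_def j_def Let_def m_def)
    show "i x \<in> (U \<times> {0..<b}) \<times> (UNIV \<times> UNIV)"
      using x rep by (auto simp: i_def Let_def)
  next
    fix x assume "x \<in> (U \<times> {0..<b}) \<times> (UNIV \<times> UNIV :: (int \<times> int) set)"
    then show "j x \<in> UNIV \<times> {0..<b} \<times> UNIV" by (auto simp: j_def)
    obtain u v t k where [simp]: "x = ((u, v), (t, k))" by (metis surj_pair)
    show "(case j x of (r, s, t) \<Rightarrow> F r s t / (1 - w' (r - c * t)))
        = (case x of (x, p) \<Rightarrow> case p of (t, k) \<Rightarrow> G (fst x) (snd x) * R (fst x) (snd x) t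
        * (K (fst x) (snd x) k / (1 - w' (b^2 * k + fst x))))"
      by (simp only: j_def case_prod_conv \<open>x = _\<close> m F_split fst_conv snd_conv) simp
  qed auto
qed

theorem sum_mult_theta:
  assumes U: "complete_residue_system (b^2) U"
  shows "(\<Sum>\<^sub>\<infinity>(r, s)\<in>UNIV. sg2 r s * G r s) * (\<Sum>\<^sub>\<infinity>t. \<Theta> t) = A_sum + B_sum U"
proof -
  define P where "P = {0..<c} \<times> (UNIV :: (int \<times> int) set)"
  let ?L = "(\<Sum>\<^sub>\<infinity>(r, s)\<in>UNIV. sg2 r s * G r s) * (\<Sum>\<^sub>\<infinity>t. \<Theta> t)"
  let ?A = "\<lambda>(r, s, t). F r s t / (1 - w (c * t - r))"
  let ?B = "\<lambda>(r, s, t). F (r + c * (s div b)) (s mod b) (t + s div b) / (1 - w' (r - c * t))"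
  have "((\<lambda>(p, t). (case p of (r, s) \<Rightarrow> sg2 r s * G r s) * \<Theta> t) has_sum ?L) (UNIV \<times> UNIV)"
    by (intro has_sum_product_complex has_sum_infsum summable_sg2_G summable_\<Theta>)
  \<comment> \<open>Each triple lies on the orbit of exactly one base point with
    \<open>0 \<le> r < c\<close>, at position \<open>r div c\<close>.\<close>
  also have "?this \<longleftrightarrow> ((\<lambda>((r, s, t), n). sg2 (r + c * n) (s - b * n) * F (r + c * n) (s - b * n) (t + n))
      has_sum ?L) (P \<times> UNIV)"
    using c_pos
    by (intro has_sum_reindex_bij_witness[where
          i = "\<lambda>((r, s, t), n). ((r + c * n, s - b * n), t + n)" and
          j = "\<lambda>((r, s), t). ((r mod c, s + b * (r div c), t - r div c), r div c)"])
      (auto simp: P_def)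
  finally have 1: "((\<lambda>p. ?A p + ?B p) has_sum ?L) P"
    by (rule has_sum_SigmaD) (use orbit_has_sum in \<open>auto simp: P_def\<close>)
  \<comment> \<open>Moving from one end of each orbit to the other is a bijection between the slices
    \<open>0 \<le> r < c\<close> and \<open>0 \<le> s < b\<close>, and it preserves
    \<open>r - c * t\<close>.\<close>
  have "(?B has_sum B_sum U) P \<longleftrightarrow>
      ((\<lambda>(r, s, t). F r s t / (1 - w' (r - c * t))) has_sum B_sum U) (UNIV \<times> {0..<b} \<times> UNIV)"
    using c_pos b_pos
    by (intro has_sum_reindex_bij_witness[where
          i = "\<lambda>(r, s, t). (r mod c, s + b * (r div c), t - r div c)" and
          j = "\<lambda>(r, s, t). (r + c * (s div b), s mod b, t + s div b)"])
      (auto simp: P_def algebra_simps)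
  then have "((\<lambda>p. ?A p + ?B p) has_sum (A_sum + B_sum U)) P"
    using A_has_sum B_has_sum[OF U] unfolding P_def by (intro has_sum_add) auto
  with 1 show ?thesis by (rule has_sum_unique)
qed

end

section \<open>From logarithms back to \<open>q\<close>, \<open>x1\<close>, \<open>x2\<close>,
  \<open>y1\<close>\<close>

theorem theorem6p1:
  fixes q \<tau> x1 x2 y1 :: complex
    and a b c D :: int
    and U :: "int set"
  assumes q: "0 < norm q" "norm q < 1" "q = exp (2 * of_real pi * \<i> * \<tau>)"
    and abc: "a > 0" "b > 0" "c > 0"
    and D: "D = b^2 - a * c" "D > 0"
    and nonzero: "x1 \<noteq> 0" "x2 \<noteq> 0" "y1 \<noteq> 0"
    and generic_theta: "(\<Sum>\<^sub>\<infinity>r2::int. qpow \<tau> (c * D * r2^2 / 2) * x2 powi r2) \<noteq> 0"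
    and generic_poles1: "\<And>t r2. t \<in> {0..<c} \<Longrightarrow>
          1 - x1 powi c * y1 powi (-b) * x2 * q powi (D * (c * r2 - t)) \<noteq> 0"
    and generic_poles2: "\<And>u k. u \<in> U \<Longrightarrow>
          1 - x1 powi (-c) * y1 powi b * x2 powi (-1) * q powi (D * (b^2 * k + u)) \<noteq> 0"
    and U: "complete_residue_system (b^2) U"
  shows
    "(\<lambda>(r1::int, s1::int). sg2 r1 s1 * qpow \<tau> (a * r1^2 / 2 + b * r1 * s1 + c * s1^2 / 2)
          * x1 powi r1 * y1 powi s1) summable_on UNIV
     \<and> (\<forall>t\<in>{0..<c}. (\<lambda>s1::int. qpow \<tau> (a * t^2 / 2 + b * t * s1 + c * s1^2 / 2)
          * x1 powi t * y1 powi s1) summable_on UNIV)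
     \<and> (\<forall>t\<in>{0..<c}. (\<lambda>r2::int. qpow \<tau> (c * D * r2^2 / 2) * x2 powi r2
          / (1 - x1 powi c * y1 powi (-b) * x2 * q powi (D * (c * r2 - t)))) summable_on UNIV)
     \<and> (\<forall>u\<in>U. \<forall>v\<in>{0..<b}. (\<lambda>r2::int. qpow \<tau> (b^2 * c * r2^2 / 2 + c * (a * u + b * v) * r2)
          * (x1 powi c * x2) powi r2) summable_on UNIV)
     \<and> (\<forall>u\<in>U. \<forall>v\<in>{0..<b}. (\<lambda>k::int. qpow \<tau> (a * b^2 * D * k^2 / 2 + (a * u + b * v) * D * k)
          * (x1 powi D * x2 powi (-a)) powi k
          / (1 - x1 powi (-c) * y1 powi b * x2 powi (-1) * q powi (D * (b^2 * k + u))))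
          summable_on UNIV)
     \<and> (\<Sum>\<^sub>\<infinity>(r1::int, s1::int)\<in>UNIV. sg2 r1 s1
          * qpow \<tau> (a * r1^2 / 2 + b * r1 * s1 + c * s1^2 / 2) * x1 powi r1 * y1 powi s1)
       = (\<Sum>t\<in>{0..<c}.
            (\<Sum>\<^sub>\<infinity>s1::int. qpow \<tau> (a * t^2 / 2 + b * t * s1 + c * s1^2 / 2)
               * x1 powi t * y1 powi s1)
            * inverse (\<Sum>\<^sub>\<infinity>r2::int. qpow \<tau> (c * D * r2^2 / 2) * x2 powi r2)
            * (\<Sum>\<^sub>\<infinity>r2::int. qpow \<tau> (c * D * r2^2 / 2) * x2 powi r2
                 / (1 - x1 powi c * y1 powi (-b) * x2 * q powi (D * (c * r2 - t)))))
         + inverse (\<Sum>\<^sub>\<infinity>r2::int. qpow \<tau> (c * D * r2^2 / 2) * x2 powi r2)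
           * (\<Sum>u\<in>U. \<Sum>v\<in>{0..<b}.
                qpow \<tau> (a * u^2 / 2 + b * u * v + c * v^2 / 2) * x1 powi u * y1 powi v
                * (\<Sum>\<^sub>\<infinity>r2::int. qpow \<tau> (b^2 * c * r2^2 / 2 + c * (a * u + b * v) * r2)
                     * (x1 powi c * x2) powi r2)
                * (\<Sum>\<^sub>\<infinity>k::int. qpow \<tau> (a * b^2 * D * k^2 / 2 + (a * u + b * v) * D * k)
                     * (x1 powi D * x2 powi (-a)) powi k
                     / (1 - x1 powi (-c) * y1 powi b * x2 powi (-1)
                            * q powi (D * (b^2 * k + u)))))"
proof -
  \<comment> \<open>The logarithm of q must be the one fixed by \<open>\<tau>\<close>, as fractional
    powers of q occur; x1, x2, y1 occur only to integer powers, so principal logarithms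
    serve.\<close>
  define \<kappa> X1 X2 Y1 where "\<kappa> = 2 * of_real pi * \<i> * \<tau>" and "X1 = Ln x1" and "X2 = Ln x2" and "Y1 = Ln y1"
  have x: "x1 = exp X1" "x2 = exp X2" "y1 = exp Y1"
    using nonzero by (simp_all add: X1_def X2_def Y1_def)
  have q': "q = exp \<kappa>" using q(3) by (simp add: \<kappa>_def)
  have qpow_eq: "qpow \<tau> e = exp (\<kappa> * of_real e)" for e
    by (simp add: qpow_def \<kappa>_def)
  have pole1_eq: "x1 powi c * y1 powi (-b) * x2 * q powi (D * m)
      = exp (of_int c * X1 - of_int b * Y1 + X2 + of_int m * (\<kappa> * of_int D))" for m
    unfolding x q' exp_power_int mult_exp_exp
    by (rule arg_cong[where f = exp]) (simp add: algebra_simps)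
  have pole2_eq: "x1 powi (-c) * y1 powi b * x2 powi (-1) * q powi (D * m)
      = exp (- of_int c * X1 + of_int b * Y1 - X2 + of_int m * (\<kappa> * of_int D))" for m
    unfolding x q' exp_power_int mult_exp_exp
    by (rule arg_cong[where f = exp]) (simp add: algebra_simps)
  interpret indefinite_theta a b c D \<kappa> X1 Y1 X2
  proof
    show "Re \<kappa> < 0" using q(2) by (simp add: q')
    fix m :: int
    \<comment> \<open>Every integer \<open>m\<close> has the form \<open>c * r2 - t\<close> with
      \<open>0 \<le> t < c\<close>, so \<open>generic_poles1\<close> excludes a pole at every
      exponent.\<close>
    have "c * (- ((- m) div c)) - (- m) mod c = m"
      by (metis add.inverse_inverse minus_add_distrib mult_div_mod_eq mult_minus_right uminus_add_conv_diff add.commute)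
    then show "exp (of_int c * X1 - of_int b * Y1 + X2 + of_int m * (\<kappa> * of_int D)) \<noteq> 1"
      using generic_poles1[of "(- m) mod c" "- ((- m) div c)"] abc unfolding pole1_eq by simp
  qed (use abc D in auto)
  have G_eq: "qpow \<tau> (a * r^2 / 2 + b * r * s + c * s^2 / 2) * x1 powi r * y1 powi s = G r s" for r s
    unfolding x qpow_eq exp_power_int mult_exp_exp G_def
    by (rule arg_cong[where f = exp]) simp
  have sg2_G_eq: "sg2 r s * qpow \<tau> (a * r^2 / 2 + b * r * s + c * s^2 / 2) * x1 powi r * y1 powi s
      = sg2 r s * G r s" for r s
    by (simp add: mult.assoc flip: G_eq)
  have Theta_eq: "qpow \<tau> (c * D * t^2 / 2) * x2 powi t = \<Theta> t" for t
    unfolding x qpow_eq exp_power_int mult_exp_exp \<Theta>_def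
    by (rule arg_cong[where f = exp]) simp
  have R_eq: "qpow \<tau> (b^2 * c * t^2 / 2 + c * (a * u + b * v) * t) * (x1 powi c * x2) powi t = R u v t" for u v t
    unfolding x qpow_eq exp_power_int mult_exp_exp R_def
    by (rule arg_cong[where f = exp]) simp
  have K_eq: "qpow \<tau> (a * b^2 * D * k^2 / 2 + (a * u + b * v) * D * k) * (x1 powi D * x2 powi (-a)) powi k = K u v k"
    for u v k
    unfolding x qpow_eq exp_power_int mult_exp_exp K_def
    by (rule arg_cong[where f = exp]) simp
  note eqs = G_eq sg2_G_eq Theta_eq R_eq K_eq pole1_eq[folded w_def] pole2_eq[folded w'_def]
  have "(\<Sum>\<^sub>\<infinity>t. \<Theta> t) \<noteq> 0"
    using generic_theta unfolding Theta_eq .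
  \<comment> \<open>The product identity is divided by the theta function, which is nonzero by
    \<open>generic_theta\<close>.\<close>
  then have "(\<Sum>\<^sub>\<infinity>(r, s)\<in>UNIV. sg2 r s * G r s) =
      (A_sum + B_sum U) * inverse (\<Sum>\<^sub>\<infinity>t. \<Theta> t)"
    using sum_mult_theta[OF U] by (simp add: field_simps)
  also have "\<dots> = (\<Sum>t\<in>{0..<c}. (\<Sum>\<^sub>\<infinity>s. G t s) * inverse (\<Sum>\<^sub>\<infinity>r. \<Theta> r)
        * (\<Sum>\<^sub>\<infinity>r. \<Theta> r / (1 - w (c * r - t))))
      + inverse (\<Sum>\<^sub>\<infinity>r. \<Theta> r) * (\<Sum>u\<in>U. \<Sum>v\<in>{0..<b}. G u v * (\<Sum>\<^sub>\<infinity>t. R u v t)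
      * (\<Sum>\<^sub>\<infinity>k. K u v k / (1 - w' (b^2 * k + u))))"
    unfolding A_sum_def B_sum_def distrib_right
    by (rule arg_cong2[where f = "(+)"], subst sum_distrib_right, simp_all only: mult_ac)
  finally show ?thesis
    unfolding eqs using summable_sg2_G summable_G summable_\<Theta>_over_w summable_R summable_K_over_w'
    by blast
qed

end
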